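(* (1) For every game $G$, the pair $(\mathsf{ts}(G),\simeq_G)$, where $\mathsf{ts}(G)$ is the set of all t-skeletons on $G$, is a complete pair, and $G=(\bigcup\mathsf{ts}(G),\simeq_G)$. (2) For every complete pair $(\mathcal S,\simeq)$, the t-skeletons on the union game $(\bigcup\mathcal S,\simeq)$ are precisely the elements of $\mathcal S$.
   Context: A move is a triple $(m,x,y)$ with $x\in\{O,P\}$ (O-move/P-move) and $y\in\{Q,A\}$ (question/answer). A justified (j-)sequence is a finite sequence $s$ of moves with a map $\mathcal J_s:\{1,\dots,|s|\}\to\{0,\dots,|s|-1\}$, $\mathcal J_s(i)<i$ (occurrence $s(i)$ initial if $\mathcal J_s(i)=0$, otherwise justified by $s(\mathcal J_s(i))$). J-sequences are equal iff they have the same moves and pointers; prefixes inherit pointers; $X^{\mathrm{Even}}$, $X^{\mathrm{Odd}}$ are the even-/odd-length elements. The P-view $\lceil s\rceil$ and O-view $\lfloor s\rfloor$ are the j-subsequences given by $\lceil\epsilon\rceil=\epsilon$, $\lceil sm\rceil=\lceil s\rceil m$ ($m$ P-move), $\lceil sm\rceil=m$ ($m$ initial), $\lceil smtn\rceil=\lceil s\rceil mn$ ($n$ O-move justified by $m$), $\lfloor\epsilon\rfloor=\epsilon$, $\lfloor sm\rfloor=\lfloor s\rfloor m$ ($m$ O-move), $\lfloor smtn\rfloor=\lfloor s\rfloor mn$ ($n$ P-move justified by $m$). A legal position is a j-sequence with alternating O/P labels in which the justifier of each non-initial P-move (O-move) occurrence lies in the P-view (O-view) of the preceding prefix. A game is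 a pair $G=(P_G,\simeq_G)$ with $P_G$ a non-empty prefix-closed set of legal positions and $\simeq_G$ an equivalence relation on $P_G$ satisfying (I1) $s\simeq_G t\Rightarrow|s|=|t|$; (I2) $sm\simeq_G tn\Rightarrow s\simeq_G t$, $m,n$ carry the same labels and equal pointers; (I3) $s\simeq_G t\wedge sm\in P_G\Rightarrow\exists tn\in P_G.\ sm\simeq_G tn$; and whose induced arena (moves occurring in $P_G$, $\star\vdash_G m$ iff $m$ occurs initially, $m\vdash_G n$ iff $n$ occurs justified by $m$) has initial moves O-questions, answers enabled only by questions, non-$\star$ enabling flipping O/P labels, and no infinite chain $\star\vdash_G m_0\vdash_G m_1\vdash_G\cdots$. For a set $S$ of j-sequences, its induced arena $(M_S,\vdash_S)$ is defined likewise. A tree (t-)skeleton is a set $S$ of legal positions satisfying (Tree) $S\neq\emptyset$ and $sm\in S\Rightarrow s\in S$, (Edet) $smn,smn'\in S^{\mathrm{Even}}\Rightarrow smn=smn'$, with well-founded induced arena (no infinite chain $\star\vdash_S m_0\vdash_S m_1\vdash_S\cdots$). For sets $S,T$ of j-sequences, $\mathsf{Oinc}(S,T)$ means $S\subseteq T$ and $s\in S\wedge sm\in T^{\mathrm{Odd}}\Rightarrow sm\in S$. A t-skeleton on a pair $(P,\simeq)$ (in particular on a game) is a t-skeleton $S$ with $\mathsf{Oinc}(S,P)$. A non-empty set $\mathcal S$ of t-skeletons is consistent if the arena $(\bigcup_{\sigma\in\mathcal S}M_\sigma,\bigcup_{\sigma\in\mathcal S}\vdash_\sigma)$ has no infinite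 chain $\star\vdash m_0\vdash m_1\vdash\cdots$, and for all $\sigma,\tau\in\mathcal S$ and $sm\in(\sigma\cup\tau)^{\mathrm{Odd}}$, $s\in\sigma\cap\tau$ implies $sm\in\sigma\cap\tau$. A consistent pair is a pair $(\mathcal S,\simeq)$ of a consistent set $\mathcal S$ and an equivalence relation $\simeq$ on $\bigcup\mathcal S$ satisfying (I1)-(I3); its union game is $(\bigcup\mathcal S,\simeq)$. A consistent pair $(\mathcal S,\simeq)$ is complete if every subset $\mathcal A\subseteq\bigcup\mathcal S$ satisfying (Tree), (Edet) and $\mathsf{Oinc}(\mathcal A,\bigcup\mathcal S)$ is an element of $\mathcal S$. *)

theory Defs
  imports Main
begin

datatype player = OMove | PMove
datatype kind = Question | Answer

type_synonym 'm move = "'m \<times> player \<times> kind"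

text \<open>A j-sequence is the list of its occurrences, each paired with its pointer. Positions in the
  mathematical sense are 1-based, so the occurrence at list index \<open>i\<close> has position \<open>Suc i\<close> and its
  pointer must be at most \<open>i\<close>. Equality of lists is then equality of moves and of pointers.\<close>

type_synonym 'm jseq = "('m move \<times> nat) list"

abbreviation mv :: "'m move \<times> nat \<Rightarrow> 'm move" where "mv \<equiv> fst"
abbreviation ptr :: "'m move \<times> nat \<Rightarrow> nat" where "ptr \<equiv> snd"

definition player_of :: "'m move \<Rightarrow> player" where "player_of m = fst (snd m)"
definition kind_of :: "'m move \<Rightarrow> kind" where "kind_of m = snd (snd m)"

definition jseq :: "'m jseq \<Rightarrow> bool" where
  "jseq s \<longleftrightarrow> (\<forall>i<length s. ptr (s ! i) \<le> i)"

text \<open>A view, being a j-subsequence of \<open>s\<close>, is given by the list of the (1-based) positions of its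
  occurrences in \<open>s\<close>. The defining clauses are tried in order, so that an initial P-move is appended
  to the P-view. The O-view of a sequence ending with an initial P-move is not covered by the usual
  clauses (in a game, initial moves are O-moves); it is taken to consist of that move alone,
  dually to the P-view. The defining clauses in snoc form are the lemmas below.\<close>

function pview :: "'m jseq \<Rightarrow> nat list" where
  "pview s =
    (if s = [] then []
     else let n = last s; j = ptr n; k = length s in
       if player_of (mv n) = PMove then pview (butlast s) @ [k]
       else if j = 0 then [k]
       else pview (take (j - 1) (butlast s)) @ [j, k])"
  by auto
termination
  by (relation "measure length") (auto simp: min_less_iff_disj)

function oview :: "'m jseq \<Rightarrow> nat list" where
  "oview s =
    (if s = [] then []
     else let n = last s; j = ptr n; k = length s in
       if player_of (mv n) = OMove then oview (butlast s) @ [k]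
       else if j = 0 then [k]
       else oview (take (j - 1) (butlast s)) @ [j, k])"
  by auto
termination
  by (relation "measure length") (auto simp: min_less_iff_disj)

declare pview.simps [simp del] oview.simps [simp del]

lemma pview_Nil: "pview [] = []"
  by (simp add: pview.simps)

lemma pview_snoc_P: "player_of (mv m) = PMove \<Longrightarrow> pview (s @ [m]) = pview s @ [Suc (length s)]"
  by (simp add: pview.simps [of "s @ [m]"])

lemma pview_snoc_initial:
  "player_of (mv m) = OMove \<Longrightarrow> ptr m = 0 \<Longrightarrow> pview (s @ [m]) = [Suc (length s)]"
  by (simp add: pview.simps [of "s @ [m]"])

lemma pview_snoc_O:
  "player_of (mv n) = OMove \<Longrightarrow> ptr n = Suc (length s) \<Longrightarrow>
    pview (s @ [m] @ t @ [n]) = pview s @ [Suc (length s), length (s @ [m] @ t @ [n])]"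
  by (simp add: pview.simps [of "s @ m # t @ [n]"] butlast_append)

lemma oview_Nil: "oview [] = []"
  by (simp add: oview.simps)

lemma oview_snoc_O: "player_of (mv m) = OMove \<Longrightarrow> oview (s @ [m]) = oview s @ [Suc (length s)]"
  by (simp add: oview.simps [of "s @ [m]"])

lemma oview_snoc_P:
  "player_of (mv n) = PMove \<Longrightarrow> ptr n = Suc (length s) \<Longrightarrow>
    oview (s @ [m] @ t @ [n]) = oview s @ [Suc (length s), length (s @ [m] @ t @ [n])]"
  by (simp add: oview.simps [of "s @ m # t @ [n]"] butlast_append)

definition legal :: "'m jseq \<Rightarrow> bool" where
  "legal s \<longleftrightarrow>
     jseq s \<and>
     (\<forall>i. Suc i < length s \<longrightarrow> player_of (mv (s ! i)) \<noteq> player_of (mv (s ! Suc i))) \<and>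
     (\<forall>i<length s. ptr (s ! i) \<noteq> 0 \<longrightarrow>
        (player_of (mv (s ! i)) = PMove \<longrightarrow> ptr (s ! i) \<in> set (pview (take i s))) \<and>
        (player_of (mv (s ! i)) = OMove \<longrightarrow> ptr (s ! i) \<in> set (oview (take i s))))"

definition Even :: "'m jseq set \<Rightarrow> 'm jseq set" where "Even X = {s \<in> X. even (length s)}"
definition Odd :: "'m jseq set \<Rightarrow> 'm jseq set" where "Odd X = {s \<in> X. odd (length s)}"

text \<open>In an enabling relation, \<open>None\<close> stands for the symbol \<open>\<star>\<close>.\<close>

type_synonym 'm enabling = "('m move option \<times> 'm move) set"
type_synonym 'm arena = "'m move set \<times> 'm enabling"

definition moves :: "'m jseq set \<Rightarrow> 'm move set" where
  "moves S = {mv (s ! i) | s i. s \<in> S \<and> i < length s}"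

definition enables :: "'m jseq set \<Rightarrow> 'm enabling" where
  "enables S =
     {(None, mv (s ! i)) | s i. s \<in> S \<and> i < length s \<and> ptr (s ! i) = 0} \<union>
     {(Some (mv (s ! (ptr (s ! i) - 1))), mv (s ! i)) | s i.
        s \<in> S \<and> i < length s \<and> ptr (s ! i) \<noteq> 0}"

definition arena :: "'m jseq set \<Rightarrow> 'm arena" where
  "arena S = (moves S, enables S)"

definition wf_arena :: "'m arena \<Rightarrow> bool" where
  "wf_arena A \<longleftrightarrow>
     \<not> (\<exists>f :: nat \<Rightarrow> 'm move. range f \<subseteq> fst A \<and>
          (None, f 0) \<in> snd A \<and> (\<forall>i. (Some (f i), f (Suc i)) \<in> snd A))"

definition game_arena :: "'m arena \<Rightarrow> bool" where
  "game_arena A \<longleftrightarrow>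
     (\<forall>m. (None, m) \<in> snd A \<longrightarrow> player_of m = OMove \<and> kind_of m = Question) \<and>
     (\<forall>m n. (Some m, n) \<in> snd A \<and> kind_of n = Answer \<longrightarrow> kind_of m = Question) \<and>
     (\<forall>m n. (Some m, n) \<in> snd A \<longrightarrow> player_of m \<noteq> player_of n) \<and>
     wf_arena A"

definition tree :: "'m jseq set \<Rightarrow> bool" where
  "tree S \<longleftrightarrow> S \<noteq> {} \<and> (\<forall>s m. s @ [m] \<in> S \<longrightarrow> s \<in> S)"

definition identification :: "'m jseq set \<Rightarrow> ('m jseq \<times> 'm jseq) set \<Rightarrow> bool" where
  "identification P R \<longleftrightarrow>
     equiv P R \<and>
     (\<forall>s t. (s, t) \<in> R \<longrightarrow> length s = length t) \<and>
     (\<forall>s t m n. (s @ [m], t @ [n]) \<in> R \<longrightarrow>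
        (s, t) \<in> R \<and> player_of (mv m) = player_of (mv n) \<and> kind_of (mv m) = kind_of (mv n) \<and>
        ptr m = ptr n) \<and>
     (\<forall>s t m. (s, t) \<in> R \<and> s @ [m] \<in> P \<longrightarrow>
        (\<exists>n. t @ [n] \<in> P \<and> (s @ [m], t @ [n]) \<in> R))"

type_synonym 'm game = "'m jseq set \<times> ('m jseq \<times> 'm jseq) set"

definition game :: "'m game \<Rightarrow> bool" where
  "game G \<longleftrightarrow>
     tree (fst G) \<and> (\<forall>s \<in> fst G. legal s) \<and> identification (fst G) (snd G) \<and>
     game_arena (arena (fst G))"

definition edet :: "'m jseq set \<Rightarrow> bool" where
  "edet S \<longleftrightarrow>
     (\<forall>s m n n'. s @ [m, n] \<in> Even S \<and> s @ [m, n'] \<in> Even S \<longrightarrow> s @ [m, n] = s @ [m, n'])"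

definition Oinc :: "'m jseq set \<Rightarrow> 'm jseq set \<Rightarrow> bool" where
  "Oinc S T \<longleftrightarrow> S \<subseteq> T \<and> (\<forall>s m. s \<in> S \<and> s @ [m] \<in> Odd T \<longrightarrow> s @ [m] \<in> S)"

definition tskel :: "'m jseq set \<Rightarrow> bool" where
  "tskel S \<longleftrightarrow> (\<forall>s \<in> S. legal s) \<and> tree S \<and> edet S \<and> wf_arena (arena S)"

definition tskel_on :: "'m jseq set \<Rightarrow> 'm game \<Rightarrow> bool" where
  "tskel_on S G \<longleftrightarrow> tskel S \<and> Oinc S (fst G)"

definition ts :: "'m game \<Rightarrow> 'm jseq set set" where
  "ts G = {S. tskel_on S G}"

definition consistent :: "'m jseq set set \<Rightarrow> bool" where
  "consistent SS \<longleftrightarrow>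
     SS \<noteq> {} \<and> (\<forall>\<sigma> \<in> SS. tskel \<sigma>) \<and>
     wf_arena (\<Union>\<sigma>\<in>SS. moves \<sigma>, \<Union>\<sigma>\<in>SS. enables \<sigma>) \<and>
     (\<forall>\<sigma> \<in> SS. \<forall>\<tau> \<in> SS. \<forall>s m.
        s @ [m] \<in> Odd (\<sigma> \<union> \<tau>) \<and> s \<in> \<sigma> \<inter> \<tau> \<longrightarrow> s @ [m] \<in> \<sigma> \<inter> \<tau>)"

type_synonym 'm skel_pair = "'m jseq set set \<times> ('m jseq \<times> 'm jseq) set"

definition consistent_pair :: "'m skel_pair \<Rightarrow> bool" where
  "consistent_pair C \<longleftrightarrow> consistent (fst C) \<and> identification (\<Union> (fst C)) (snd C)"

definition union_game :: "'m skel_pair \<Rightarrow> 'm game" where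
  "union_game C = (\<Union> (fst C), snd C)"

definition complete_pair :: "'m skel_pair \<Rightarrow> bool" where
  "complete_pair C \<longleftrightarrow>
     consistent_pair C \<and>
     (\<forall>A. A \<subseteq> \<Union> (fst C) \<and> tree A \<and> edet A \<and> Oinc A (\<Union> (fst C)) \<longrightarrow> A \<in> fst C)"

end

(* The only real point is that every position s of a game lies in some t-skeleton on the game.
   The even-length prefixes of s, together with all odd-length one-move extensions of them that
   the game admits, form such a t-skeleton: it is deterministic because its even-length elements
   are linearly ordered. *)

theory Submission
  imports Defs "HOL-Library.Sublist"
begin

lemma wf_arena_mono:
  assumes "wf_arena (M, E)" and "M' \<subseteq> M" and "E' \<subseteq> E"
  shows "wf_arena (M', E')"
  using assms unfolding wf_arena_def fst_conv snd_conv by (meson subset_iff)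

lemma moves_mono: "S \<subseteq> T \<Longrightarrow> moves S \<subseteq> moves T"
  unfolding moves_def by blast

lemma enables_mono: "S \<subseteq> T \<Longrightarrow> enables S \<subseteq> enables T"
  unfolding enables_def by blast

lemma wf_arena_subset: "wf_arena (arena T) \<Longrightarrow> S \<subseteq> T \<Longrightarrow> wf_arena (arena S)"
  unfolding arena_def by (rule wf_arena_mono[OF _ moves_mono enables_mono])

lemma tree_prefix_closed:
  assumes "tree S" and "t \<in> S" and "prefix s t"
  shows "s \<in> S"
proof -
  have "s @ u \<in> S \<Longrightarrow> s \<in> S" for u
  proof (induction u rule: rev_induct)
    case (snoc m u)
    then have "(s @ u) @ [m] \<in> S" by simp
    with \<open>tree S\<close> have "s @ u \<in> S" unfolding tree_def by blast
    then show ?case by (rule snoc.IH)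
  qed simp
  with assms show ?thesis by (auto simp: prefix_def)
qed

text \<open>Encodes the even-length prefixes of \<open>s\<close> together with their one-move
  extensions in \<open>P\<close>. Testing all even-length prefixes of \<open>t\<close> avoids a case
  split on parity and makes closure under prefixes immediate.\<close>

definition line :: "'m jseq set \<Rightarrow> 'm jseq \<Rightarrow> 'm jseq set" where
  "line P s = {t \<in> P. \<forall>u. prefix u t \<and> even (length u) \<longrightarrow> prefix u s}"

lemma self_in_line: "s \<in> P \<Longrightarrow> s \<in> line P s"
  unfolding line_def by blast

lemma tree_line:
  assumes "tree P"
  shows "tree (line P s)"
proof -
  obtain t where "t \<in> P" using assms unfolding tree_def by blast
  then have "[] \<in> P" by (rule tree_prefix_closed[OF assms]) simp
  then have "[] \<in> line P s" unfolding line_def by simp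
  moreover have "t \<in> line P s" if "t @ [m] \<in> line P s" for t m
  proof -
    have "t @ [m] \<in> P" using that unfolding line_def by blast
    then have "t \<in> P" using assms unfolding tree_def by blast
    with that show ?thesis by (simp add: line_def)
  qed
  ultimately show ?thesis unfolding tree_def by blast
qed

text \<open>Two even-length elements are themselves prefixes of \<open>s\<close>; having the same
  length, they coincide.\<close>

lemma edet_line: "edet (line P s)"
proof -
  have "n = n'" if "t @ [m, n] \<in> Even (line P s)" "t @ [m, n'] \<in> Even (line P s)" for t m n n'
  proof -
    have "prefix (t @ [m, n]) s" "prefix (t @ [m, n']) s"
      using that unfolding line_def Even_def by blast+
    then show ?thesis by (auto simp: prefix_def)
  qed
  then show ?thesis unfolding edet_def by blast
qed

text \<open>An odd-length \<open>t @ [m]\<close> has no even-length prefixes beyond those of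
  \<open>t\<close>, so the extension meets no new condition.\<close>

lemma Oinc_line: "Oinc (line P s) P"
  unfolding Oinc_def line_def Odd_def by auto

text \<open>Legality and well-foundedness pass from the game to subsets, which leaves exactly the
  three conditions in the definition of completeness.\<close>

lemma tskel_onI:
  assumes "game G" and "tree A" and "edet A" and "Oinc A (fst G)"
  shows "tskel_on A G"
proof -
  have sub: "A \<subseteq> fst G" using assms(4) unfolding Oinc_def by (rule conjunct1)
  have legal: "\<forall>s \<in> fst G. legal s" and wf: "wf_arena (arena (fst G))"
    using assms(1) by (simp_all add: game_def game_arena_def)
  from legal sub have "\<forall>s \<in> A. legal s" by blast
  with wf_arena_subset[OF wf sub] assms show ?thesis
    by (simp add: tskel_on_def tskel_def)
qed

lemma tskel_on_line: "game G \<Longrightarrow> tskel_on (line (fst G) s) G"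
  by (rule tskel_onI) (simp_all add: game_def tree_line edet_line Oinc_line)

lemma Union_ts:
  assumes "game G"
  shows "\<Union> (ts G) = fst G"
proof
  show "\<Union> (ts G) \<subseteq> fst G" unfolding ts_def tskel_on_def Oinc_def by blast
  show "fst G \<subseteq> \<Union> (ts G)"
    using tskel_on_line[OF assms] self_in_line unfolding ts_def by blast
qed

lemma consistent_ts:
  assumes "game G"
  shows "consistent (ts G)"
proof -
  have sub: "\<sigma> \<subseteq> fst G" and skel: "tskel \<sigma>" and oinc: "Oinc \<sigma> (fst G)" if "\<sigma> \<in> ts G" for \<sigma>
    using that unfolding ts_def tskel_on_def Oinc_def by auto
  have "wf_arena (moves (fst G), enables (fst G))"
    using assms by (simp add: game_def game_arena_def arena_def)
  then have wf: "wf_arena (\<Union>\<sigma>\<in>ts G. moves \<sigma>, \<Union>\<sigma>\<in>ts G. enables \<sigma>)"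
    by (rule wf_arena_mono) (intro UN_least moves_mono enables_mono sub, assumption)+
  have odd: "s @ [m] \<in> \<sigma> \<inter> \<tau>"
    if "\<sigma> \<in> ts G" "\<tau> \<in> ts G" "s @ [m] \<in> Odd (\<sigma> \<union> \<tau>)" "s \<in> \<sigma> \<inter> \<tau>" for \<sigma> \<tau> s m
  proof -
    \<comment> \<open>Once the extension is a position of the game, \<open>Oinc\<close> forces it
      into each skeleton containing \<open>s\<close>.\<close>
    have "s @ [m] \<in> Odd (fst G)" using that sub unfolding Odd_def by blast
    then show ?thesis using that oinc unfolding Oinc_def by blast
  qed
  have "ts G \<noteq> {}" using tskel_on_line[OF assms] unfolding ts_def by blast
  with skel wf odd show ?thesis unfolding consistent_def by blast
qed

lemma complete_pair_ts:
  assumes "game G"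
  shows "complete_pair (ts G, snd G)"
proof -
  have "tskel_on A G" if "tree A" "edet A" "Oinc A (fst G)" for A
    using assms that by (rule tskel_onI)
  moreover have "identification (fst G) (snd G)" using assms by (simp add: game_def)
  ultimately show ?thesis
    using consistent_ts[OF assms]
    \<comment> \<open>The unfolding of \<open>ts_def\<close> is delayed so that
      \<open>Union_ts\<close> can first rewrite the union to \<open>fst G\<close>.\<close>
    by (simp add: complete_pair_def consistent_pair_def Union_ts[OF assms]) (simp add: ts_def)
qed

text \<open>The extension \<open>s @ [m]\<close> comes from some \<tau> in \<open>SS\<close>, which
  contains \<open>s\<close> by prefix closure; consistency of \<sigma> with \<tau> then transfers
  the extension to \<sigma>.\<close>

lemma consistent_imp_Oinc_Union:
  assumes "consistent SS" and "\<sigma> \<in> SS"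
  shows "Oinc \<sigma> (\<Union> SS)"
proof -
  have "s @ [m] \<in> \<sigma>" if "s \<in> \<sigma>" and "s @ [m] \<in> Odd (\<Union> SS)" for s m
  proof -
    from that(2) obtain \<tau> where \<tau>: "\<tau> \<in> SS" "s @ [m] \<in> \<tau>" and "odd (length (s @ [m]))"
      unfolding Odd_def by blast
    then have "s @ [m] \<in> Odd (\<sigma> \<union> \<tau>)" unfolding Odd_def by blast
    moreover have "s \<in> \<tau>"
      using assms(1) \<tau> unfolding consistent_def tskel_def tree_def by blast
    ultimately show ?thesis
      using assms that(1) \<tau>(1) unfolding consistent_def by blast
  qed
  then show ?thesis using assms(2) unfolding Oinc_def by blast
qed

text \<open>Completeness gives the forward direction, consistency the backward one.\<close>

lemma tskel_on_union_game_iff: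
  assumes "complete_pair (SS, R)"
  shows "tskel_on \<sigma> (union_game (SS, R)) \<longleftrightarrow> \<sigma> \<in> SS"
proof
  assume "tskel_on \<sigma> (union_game (SS, R))"
  then show "\<sigma> \<in> SS"
    using assms
    by (auto simp: tskel_on_def tskel_def union_game_def complete_pair_def Oinc_def)
next
  assume "\<sigma> \<in> SS"
  moreover have "consistent SS"
    using assms by (simp add: complete_pair_def consistent_pair_def)
  ultimately show "tskel_on \<sigma> (union_game (SS, R))"
    using consistent_imp_Oinc_Union
    by (auto simp: tskel_on_def union_game_def consistent_def)
qed

theorem mainTheorem6:
  "(\<forall>G :: 'm game. game G \<longrightarrow>
      complete_pair (ts G, snd G) \<and> G = union_game (ts G, snd G)) \<and>
   (\<forall>(\<S> :: 'm jseq set set) R. complete_pair (\<S>, R) \<longrightarrow>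
      {\<sigma>. tskel_on \<sigma> (union_game (\<S>, R))} = \<S>)"
  \<comment> \<open>Instantiating \<open>union_game_def\<close> keeps the union game of an arbitrary
    pair folded, so that \<open>tskel_on_union_game_iff\<close> still matches.\<close>
  by (auto simp: complete_pair_ts union_game_def[of "(ts _, _)"] Union_ts tskel_on_union_game_iff)

end
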